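(* Let $k$ be a perfect field of characteristic different from $2$, let $g$ be a positive integer, and let $f\in k[X]$ be a polynomial of degree $2g+2$ whose leading coefficient is not a square in $k^\times$, such that $Y^2=f$ defines a hyperelliptic curve $\mathcal C$ of genus $g$ (i.e. $f$ has no repeated roots). Let $K=k(X)[Y]/(Y^2-f)$ be its function field, $\mathcal Q=k(X)$, and $\mathcal O_K=k[X,Y]/(Y^2-f)$ (the integral closure of $k[X]$ in $K$). Then \[M(K)=2g.\]
   Context: On $\mathcal Q$, $\deg$ is the degree at infinity: $\deg(a/b)=\deg(a)-\deg(b)$ for polynomials $a,b\neq0$, and $\deg(0)=-\infty$. The Euclidean minimum is \[M(K)=\max_{x\in K}\min_{y\in\mathcal O_K}\deg\big(N_{K/\mathcal Q}(x-y)\big).\] (Equivalently, $\mathcal O_K$ is the ring of functions on $\mathcal C$ regular outside the two points at infinity, which are conjugate under $\mathrm{Gal}(\bar k/k)$.) *)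

theory Defs
  imports
    "HOL-Library.Extended"
    "HOL-Computational_Algebra.Polynomial_Factorial"
    "HOL-Algebra.QuotRing"
    "HOL-Algebra.Algebraic_Closure_Type"
    "Jordan_Normal_Form.Determinant"
begin

text \<open>Roots are counted in an algebraic closure; \<^const>\<open>rsquarefree\<close> over the base
  field itself would only see the rational roots.\<close>

definition no_repeated_roots :: "'a::field poly \<Rightarrow> bool" where
  "no_repeated_roots p \<longleftrightarrow> rsquarefree (map_poly to_ac p)"

definition perfect_field :: "'a::field itself \<Rightarrow> bool" where
  "perfect_field _ \<longleftrightarrow> (\<forall>p :: 'a poly. irreducible p \<longrightarrow> no_repeated_roots p)"

definition deg_infinity :: "'a::field poly fract \<Rightarrow> int extended" where
  "deg_infinity q =
     (if q = 0 then Minf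
      else Fin (THE d. \<exists>a b. a \<noteq> 0 \<and> b \<noteq> 0 \<and> q = Fract a b \<and> d = int (degree a) - int (degree b)))"

lemma deg_infinity_0: "deg_infinity 0 = Minf"
  by (simp add: deg_infinity_def)

lemma deg_infinity_Fract:
  fixes a b :: "'a::field poly"
  assumes "a \<noteq> 0" "b \<noteq> 0"
  shows "deg_infinity (Fract a b) = Fin (int (degree a) - int (degree b))"
proof -
  have "(THE d. \<exists>a' b'. a' \<noteq> 0 \<and> b' \<noteq> 0 \<and> Fract a b = Fract a' b' \<and>
          d = int (degree a') - int (degree b')) = int (degree a) - int (degree b)"
  proof (rule the_equality)
    show "\<exists>a' b'. a' \<noteq> 0 \<and> b' \<noteq> 0 \<and> Fract a b = Fract a' b' \<and>
        int (degree a) - int (degree b) = int (degree a') - int (degree b')"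
      using assms by blast
  next
    fix d
    assume "\<exists>a' b'. a' \<noteq> 0 \<and> b' \<noteq> 0 \<and> Fract a b = Fract a' b' \<and>
        d = int (degree a') - int (degree b')"
    then obtain a' b' where *: "a' \<noteq> 0" "b' \<noteq> 0" "Fract a b = Fract a' b'"
      "d = int (degree a') - int (degree b')"
      by blast
    then have "a * b' = a' * b"
      using assms by (simp add: eq_fract)
    then have "degree a + degree b' = degree a' + degree b"
      using * assms by (metis degree_mult_eq)
    then show "d = int (degree a) - int (degree b)"
      using * by linarith
  qed
  moreover have "Fract a b \<noteq> 0"
    using assms by (simp add: Zero_fract_def eq_fract)
  ultimately show ?thesis
    by (simp add: deg_infinity_def)
qed

text \<open>The field \<open>k(X)\<close> is the type \<^typ>\<open>'a poly fract\<close>, and \<open>k(X)[Y]\<close> is the type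
  \<^typ>\<open>'a poly fract poly\<close>; the elements of \<open>K = k(X)[Y]/(Y\<^sup>2 - f)\<close> are cosets.\<close>

definition curve_ideal :: "'a::field poly \<Rightarrow> 'a poly fract poly set" where
  "curve_ideal f = PIdl\<^bsub>ring_of_type_algebra\<^esub> [:- to_fract f, 0, 1:]"

definition function_field :: "'a::field poly \<Rightarrow> 'a poly fract poly set ring" where
  "function_field f = ring_of_type_algebra Quot curve_ideal f"

definition residue_class :: "'a::field poly \<Rightarrow> 'a poly fract poly \<Rightarrow> 'a poly fract poly set" where
  "residue_class f p = curve_ideal f +>\<^bsub>ring_of_type_algebra\<^esub> p"

text \<open>The image in \<open>K\<close> of \<open>k[X][Y]\<close>. As \<open>Y\<^sup>2 - f\<close> is monic in \<open>Y\<close>, the kernel of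
  \<open>k[X][Y] \<rightarrow> K\<close> is the ideal of \<open>k[X][Y]\<close> generated by \<open>Y\<^sup>2 - f\<close>, so that this is
  \<open>k[X,Y]/(Y\<^sup>2 - f)\<close> as a subring of \<open>K\<close>.\<close>

definition integer_ring :: "'a::field poly \<Rightarrow> 'a poly fract poly set set" where
  "integer_ring f = range (\<lambda>P :: 'a poly poly. residue_class f (map_poly to_fract P))"

text \<open>The norm \<open>N\<close> of \<open>K\<close> over \<open>k(X)\<close> is the determinant of multiplication by \<open>x\<close>,
  here written in the basis \<open>1, Y\<close>. Each coset contains exactly one polynomial of
  degree at most \<open>1\<close> in \<open>Y\<close>, whose coefficients are the coordinates.\<close>

definition coordinate :: "'a::field poly fract poly set \<Rightarrow> nat \<Rightarrow> 'a poly fract" where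
  "coordinate x i = coeff (THE p. p \<in> x \<and> degree p \<le> 1) i"

definition mult_matrix :: "'a::field poly \<Rightarrow> 'a poly fract poly set \<Rightarrow> 'a poly fract mat" where
  "mult_matrix f x =
     mat 2 2 (\<lambda>(i, j). coordinate (x \<otimes>\<^bsub>function_field f\<^esub> residue_class f (monom 1 j)) i)"

definition field_norm :: "'a::field poly \<Rightarrow> 'a poly fract poly set \<Rightarrow> 'a poly fract" where
  "field_norm f x = det (mult_matrix f x)"

definition norm_deg ::
    "'a::field poly \<Rightarrow> 'a poly fract poly set \<Rightarrow> 'a poly fract poly set \<Rightarrow> int extended" where
  "norm_deg f x y = deg_infinity (field_norm f (x \<ominus>\<^bsub>function_field f\<^esub> y))"

text \<open>The next two constants are unspecified when the minimum, respectively the maximum, is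
  not attained, so attainment has to be asserted separately.\<close>

definition min_norm_deg :: "'a::field poly \<Rightarrow> 'a poly fract poly set \<Rightarrow> int extended" where
  "min_norm_deg f x = (LEAST d. d \<in> norm_deg f x ` integer_ring f)"

definition euclidean_minimum :: "'a::field poly \<Rightarrow> int extended" where
  "euclidean_minimum f = (GREATEST m. m \<in> min_norm_deg f ` carrier (function_field f))"

end

theory Submission
  imports Defs
begin

text \<open>For \<open>x = (A + B Y) / D\<close> with polynomials \<open>A\<close>, \<open>B\<close>, \<open>D\<close> one has
  \<open>N x = (A\<^sup>2 - f B\<^sup>2) / D\<^sup>2\<close>. The leading terms of \<open>A\<^sup>2\<close> and \<open>f B\<^sup>2\<close> cannot cancel because
  the leading coefficient of \<open>f\<close> is not a square. So the degree of the norm is the larger of the degrees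
  of the two terms, and subtracting integers amounts to changing \<open>A\<close> and \<open>B\<close> modulo \<open>D\<close>:
  the minimum is attained at the remainders. These have degree at most \<open>deg D - 1\<close>, which gives
  the bound \<open>2 g\<close>, and the element \<open>Y / X\<close> attains it.\<close>

subsection \<open>Arithmetic in the function field\<close>

text \<open>Division by a monic polynomial needs no inverses, hence an arbitrary commutative ring:
  over k(X) it gives representatives u + v Y for all of K, over k[X] for the integers. In the
  induction Y (a + b Y) = b (Y^2 - f) + b f + a Y.\<close>

lemma poly_mod_Y2_minus:
  fixes f :: "'a::comm_ring_1" and p :: "'a poly"
  shows "\<exists>q a b. p = q * [:- f, 0, 1:] + [:a, b:]"
proof (induction p)
  case 0
  have "0 = 0 * [:- f, 0, 1:] + [:0, 0:]" by simp
  then show ?case by blast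
next
  case (pCons c p)
  then obtain q a b where p: "p = q * [:- f, 0, 1:] + [:a, b:]" by blast
  have "pCons c p = (pCons b q) * [:- f, 0, 1:] + [:c + b * f, a:]"
    unfolding p by (simp add: algebra_simps)
  then show ?case by blast
qed

section \<open>Residue classes modulo Y^2 - f\<close>

lemma ring_of_type_algebra_simps:
  "carrier ring_of_type_algebra = UNIV"
  "monoid.mult ring_of_type_algebra = (*)"
  "add ring_of_type_algebra = (+)"
  by (simp_all add: ring_of_type_algebra_def)

text \<open>The ring record contains addition, while subtraction is derived from inverses. The
  difference is therefore identified by what it gives when \<open>y\<close> is added back.\<close>

lemma minus_ring_of_type_algebra:
  fixes x y :: "'a::comm_ring_1"
  shows "x \<ominus>\<^bsub>ring_of_type_algebra\<^esub> y = x - y"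
proof -
  interpret R: cring "ring_of_type_algebra :: 'a ring" by (rule cring_from_type_algebra)
  have "(x \<ominus>\<^bsub>ring_of_type_algebra\<^esub> y) \<oplus>\<^bsub>ring_of_type_algebra\<^esub> y = x"
    by (simp add: R.minus_eq R.a_assoc R.l_neg ring_of_type_algebra_simps(1))
  then show ?thesis
    by (simp add: ring_of_type_algebra_simps eq_diff_eq)
qed

lemma curve_ideal_eq: "curve_ideal f = range (\<lambda>q. q * [:- to_fract f, 0, 1:])"
  by (auto simp: curve_ideal_def cgenideal_def ring_of_type_algebra_simps)

lemma ideal_curve_ideal: "ideal (curve_ideal f) ring_of_type_algebra"
  unfolding curve_ideal_def
  by (rule cring.cgenideal_ideal[OF cring_from_type_algebra]) (simp add: ring_of_type_algebra_simps)

lemma residue_class_hom: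
  "ring_hom_ring ring_of_type_algebra (function_field f) (residue_class f)"
  unfolding function_field_def residue_class_def[abs_def]
  by (rule ideal.rcos_ring_hom_ring[OF ideal_curve_ideal])

lemma residue_class_mult:
  "residue_class f p \<otimes>\<^bsub>function_field f\<^esub> residue_class f q = residue_class f (p * q)"
proof -
  interpret ring_hom_ring ring_of_type_algebra "function_field f" "residue_class f"
    by (rule residue_class_hom)
  show ?thesis
    using hom_mult[of p q] by (simp add: ring_of_type_algebra_simps)
qed

lemma residue_class_minus:
  "residue_class f p \<ominus>\<^bsub>function_field f\<^esub> residue_class f q = residue_class f (p - q)"
proof -
  interpret ring_hom_ring ring_of_type_algebra "function_field f" "residue_class f"
    by (rule residue_class_hom)
  have "residue_class f (p \<ominus>\<^bsub>ring_of_type_algebra\<^esub> q)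
      = residue_class f p \<ominus>\<^bsub>function_field f\<^esub> residue_class f q"
    by (simp add: R.minus_eq S.minus_eq ring_of_type_algebra_simps(1))
  then show ?thesis
    by (simp add: minus_ring_of_type_algebra)
qed

lemma mem_residue_class_iff:
  "p \<in> residue_class f r \<longleftrightarrow> (\<exists>q. p = q * [:- to_fract f, 0, 1:] + r)"
  by (auto simp: residue_class_def curve_ideal_eq a_r_coset_def' ring_of_type_algebra_simps)

lemma residue_class_add_multiple:
  "residue_class f (q * [:- to_fract f, 0, 1:] + r) = residue_class f r"
proof (intro equalityI subsetI)
  fix p assume "p \<in> residue_class f (q * [:- to_fract f, 0, 1:] + r)"
  then obtain s where "p = s * [:- to_fract f, 0, 1:] + (q * [:- to_fract f, 0, 1:] + r)"
    by (auto simp: mem_residue_class_iff)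
  then have "p = (s + q) * [:- to_fract f, 0, 1:] + r" by (simp only: distrib_right add.assoc)
  then show "p \<in> residue_class f r" by (auto simp only: mem_residue_class_iff)
next
  fix p assume "p \<in> residue_class f r"
  then obtain s where "p = s * [:- to_fract f, 0, 1:] + r"
    by (auto simp: mem_residue_class_iff)
  then have "p = (s - q) * [:- to_fract f, 0, 1:] + (q * [:- to_fract f, 0, 1:] + r)"
    by (simp only: left_diff_distrib add.assoc[symmetric] diff_add_cancel)
  then show "p \<in> residue_class f (q * [:- to_fract f, 0, 1:] + r)"
    by (auto simp only: mem_residue_class_iff)
qed

lemma carrier_function_field:
  "carrier (function_field f) = range (\<lambda>(u, v). residue_class f [:u, v:])"
proof -
  have "carrier (function_field f) = range (residue_class f)"
    by (auto simp: function_field_def FactRing_def A_RCOSETS_def' ring_of_type_algebra_simps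
        residue_class_def)
  also have "\<dots> = range (\<lambda>(u, v). residue_class f [:u, v:])"
  proof (intro equalityI subsetI)
    fix x assume "x \<in> range (residue_class f)"
    then obtain p where x: "x = residue_class f p" by blast
    obtain q a b where p: "p = q * [:- to_fract f, 0, 1:] + [:a, b:]"
      using poly_mod_Y2_minus by blast
    have "x = (\<lambda>(u, v). residue_class f [:u, v:]) (a, b)"
      unfolding x p residue_class_add_multiple by simp
    then show "x \<in> range (\<lambda>(u, v). residue_class f [:u, v:])" by blast
  qed auto
  finally show ?thesis .
qed

lemma fract_poly_pCons: "fract_poly (pCons a p) = pCons (to_fract a) (fract_poly p)"
  by (rule map_poly_pCons) simp

text \<open>The division by Y^2 - f already takes place in k[X][Y], so quotient and remainder keep
  polynomial coefficients, and \<open>fract_poly\<close> carries the identity over to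
  k(X)[Y].\<close>

lemma integer_ring_eq:
  "integer_ring f = range (\<lambda>(a, b). residue_class f [:to_fract a, to_fract b:])"
proof (intro equalityI subsetI)
  fix x assume "x \<in> integer_ring f"
  then obtain P where x: "x = residue_class f (fract_poly P)" by (auto simp: integer_ring_def)
  obtain q a b where P: "P = q * [:- f, 0, 1:] + [:a, b:]"
    using poly_mod_Y2_minus by blast
  have "fract_poly P = fract_poly q * [:- to_fract f, 0, 1:] + [:to_fract a, to_fract b:]"
    unfolding P by (simp only: fract_poly_add fract_poly_mult fract_poly_pCons map_poly_0
        to_fract_0 to_fract_1 to_fract_uminus)
  then have "x = (\<lambda>(a, b). residue_class f [:to_fract a, to_fract b:]) (a, b)"
    unfolding x by (simp only: residue_class_add_multiple prod.case)
  then show "x \<in> range (\<lambda>(a, b). residue_class f [:to_fract a, to_fract b:])" by blast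
next
  fix x assume "x \<in> range (\<lambda>(a, b). residue_class f [:to_fract a, to_fract b:])"
  then obtain a b where "x = residue_class f (fract_poly [:a, b:])"
    by (auto simp: fract_poly_pCons)
  then show "x \<in> integer_ring f" by (auto simp: integer_ring_def)
qed

text \<open>A nonzero multiple of Y^2 - f has degree at least 2 in Y, so two representatives of
  degree at most 1 coincide; this resolves the definite description in
  \<open>coordinate\<close>.\<close>

lemma coordinate_residue_class:
  "coordinate (residue_class f [:u, v:]) i = coeff [:u, v:] i"
proof -
  have "(THE p. p \<in> residue_class f [:u, v:] \<and> degree p \<le> 1) = [:u, v:]"
  proof (rule the_equality)
    have "[:u, v:] = 0 * [:- to_fract f, 0, 1:] + [:u, v:]" by simp
    then show "[:u, v:] \<in> residue_class f [:u, v:] \<and> degree [:u, v:] \<le> 1"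
      by (auto simp only: mem_residue_class_iff) simp
  next
    fix p assume p: "p \<in> residue_class f [:u, v:] \<and> degree p \<le> 1"
    then obtain q where q: "p = q * [:- to_fract f, 0, 1:] + [:u, v:]"
      by (auto simp: mem_residue_class_iff)
    have "degree (q * [:- to_fract f, 0, 1:]) = degree (p - [:u, v:])"
      unfolding q by simp
    also have "\<dots> \<le> 1"
      using p by (intro degree_diff_le) auto
    finally have "q = 0"
      using degree_mult_eq[of q "[:- to_fract f, 0, 1:]"] by fastforce
    then show "p = [:u, v:]" using q by simp
  qed
  then show ?thesis by (simp add: coordinate_def)
qed

section \<open>The norm as a quadratic form\<close>

lemma det_mat_2:
  "det (mat 2 2 h) = h (0, 0) * h (1, 1) - h (0, 1) * (h (1, 0) :: 'a::comm_ring_1)"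
proof -
  have "det (mat 2 2 h) = (\<Sum>j<2. mat 2 2 h $$ (0, j) * cofactor (mat 2 2 h) 0 j)"
    by (rule laplace_expansion_row[of _ 2]) simp_all
  also have "\<dots> = h (0, 0) * h (1, 1) - h (0, 1) * h (1, 0)"
    by (simp add: numeral_2_eq_2 cofactor_def det_single mat_delete_def)
  finally show ?thesis .
qed

text \<open>The columns of the matrix come from (u + v Y) 1 = u + v Y and (u + v Y) Y = f v + u Y
  modulo Y^2 - f.\<close>

lemma field_norm_residue_class:
  "field_norm f (residue_class f [:u, v:]) = u\<^sup>2 - to_fract f * v\<^sup>2"
proof -
  have 0: "residue_class f [:u, v:] \<otimes>\<^bsub>function_field f\<^esub> residue_class f (monom 1 0)
      = residue_class f [:u, v:]"
    by (simp add: residue_class_mult flip: one_pCons)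
  have "[:u, v:] * monom 1 (Suc 0) = [:v:] * [:- to_fract f, 0, 1:] + [:to_fract f * v, u:]"
    by (simp add: monom_Suc monom_0 algebra_simps)
  then have 1: "residue_class f [:u, v:] \<otimes>\<^bsub>function_field f\<^esub> residue_class f (monom 1 (Suc 0))
      = residue_class f [:to_fract f * v, u:]"
    by (simp only: residue_class_mult residue_class_add_multiple)
  show ?thesis
    unfolding field_norm_def mult_matrix_def
    by (simp add: det_mat_2 0[simplified] 1 coordinate_residue_class power2_eq_square algebra_simps)
qed

subsection \<open>Degrees of norms\<close>

lemma degree_square_minus:
  fixes f A B :: "'a::field poly"
  assumes nsq: "\<nexists>c. lead_coeff f = c ^ 2"
  shows "degree (A\<^sup>2 - f * B\<^sup>2) = max (degree (A\<^sup>2)) (degree (f * B\<^sup>2))"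
    and "A\<^sup>2 - f * B\<^sup>2 = 0 \<longleftrightarrow> A = 0 \<and> B = 0"
proof -
  \<comment> \<open>The zero polynomial has leading coefficient 0, which is the square of 0.\<close>
  have f0: "f \<noteq> 0" using nsq by (metis coeff_0 power_zero_numeral)
  have "degree (A\<^sup>2 - f * B\<^sup>2) = max (degree (A\<^sup>2)) (degree (f * B\<^sup>2)) \<and> A\<^sup>2 - f * B\<^sup>2 \<noteq> 0"
    if AB: "A \<noteq> 0" "B \<noteq> 0"
  proof -
    have "lead_coeff (A\<^sup>2) \<noteq> lead_coeff (f * B\<^sup>2)"
    proof
      assume "lead_coeff (A\<^sup>2) = lead_coeff (f * B\<^sup>2)"
      then have "(lead_coeff A)\<^sup>2 = lead_coeff f * (lead_coeff B)\<^sup>2"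
        by (simp only: lead_coeff_mult lead_coeff_power)
      then have "lead_coeff f = (lead_coeff A / lead_coeff B)\<^sup>2"
        using AB by (simp add: power_divide)
      then show False using nsq by blast
    qed
    \<comment> \<open>At the larger of the two degrees the coefficient is, up to sign, one of the
      two leading coefficients, or their difference if the degrees agree.\<close>
    then have c: "coeff (A\<^sup>2 - f * B\<^sup>2) (max (degree (A\<^sup>2)) (degree (f * B\<^sup>2))) \<noteq> 0"
    proof (cases "degree (A\<^sup>2)" "degree (f * B\<^sup>2)" rule: linorder_cases)
      case less
      then have "coeff (A\<^sup>2) (degree (f * B\<^sup>2)) = 0" by (rule coeff_eq_0)
      moreover have "lead_coeff (f * B\<^sup>2) \<noteq> 0" using AB f0 by (simp only: leading_coeff_0_iff) simp
      ultimately show ?thesis using less by (simp only: coeff_diff max.absorb2 less_imp_le) simp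
    next
      case equal
      then show ?thesis
        using \<open>lead_coeff (A\<^sup>2) \<noteq> lead_coeff (f * B\<^sup>2)\<close>
        by (simp only: coeff_diff max.idem right_minus_eq not_False_eq_True)
    next
      case greater
      then have "coeff (f * B\<^sup>2) (degree (A\<^sup>2)) = 0" by (rule coeff_eq_0)
      moreover have "lead_coeff (A\<^sup>2) \<noteq> 0" using AB by (simp only: leading_coeff_0_iff) simp
      ultimately show ?thesis using greater by (simp only: coeff_diff max.absorb1 less_imp_le) simp
    qed
    then have "max (degree (A\<^sup>2)) (degree (f * B\<^sup>2)) \<le> degree (A\<^sup>2 - f * B\<^sup>2)"
      by (rule le_degree)
    then show ?thesis
      using degree_diff_le_max[of "A\<^sup>2" "f * B\<^sup>2"] c by (metis antisym coeff_0)
  qed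
  \<comment> \<open>If \<open>A\<close> or \<open>B\<close> is 0, at most one term remains; the
    convention \<open>degree 0 = 0\<close> keeps the maximum correct.\<close>
  then show "degree (A\<^sup>2 - f * B\<^sup>2) = max (degree (A\<^sup>2)) (degree (f * B\<^sup>2))"
    and "A\<^sup>2 - f * B\<^sup>2 = 0 \<longleftrightarrow> A = 0 \<and> B = 0"
    using f0 by (cases "A = 0"; cases "B = 0"; simp)+
qed

section \<open>Reduction modulo a common denominator\<close>

lemma fract_common_denominator:
  fixes u v :: "'a::idom fract"
  obtains A B D where "D \<noteq> 0" "u = Fract A D" "v = Fract B D"
proof -
  obtain a b where u: "u = Fract a b" "b \<noteq> 0" by (cases u) auto
  obtain c d where v: "v = Fract c d" "d \<noteq> 0" by (cases v) auto
  show ?thesis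
    by (rule that[of "b * d" "a * d" "c * b"]) (use u v in \<open>simp_all add: eq_fract\<close>)
qed

text \<open>Subtracting polynomials leaves the denominator \<open>D\<close> in place, so for varying
  \<open>a\<close> and \<open>b\<close> only the degrees of the numerators have to be
  compared.\<close>

lemma norm_deg_eq:
  assumes "D \<noteq> 0"
  shows "norm_deg f (residue_class f [:Fract A D, Fract B D:])
      (residue_class f [:to_fract a, to_fract b:])
    = deg_infinity (Fract ((A - a * D)\<^sup>2 - f * (B - b * D)\<^sup>2) (D\<^sup>2))"
proof -
  have "Fract A D - to_fract a = to_fract (A - a * D) / to_fract D"
    "Fract B D - to_fract b = to_fract (B - b * D) / to_fract D"
    using assms by (simp_all add: Fract_conv_to_fract field_simps)
  moreover have "(to_fract A' / to_fract D)\<^sup>2 - to_fract f * (to_fract B' / to_fract D)\<^sup>2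
      = Fract (A'\<^sup>2 - f * B'\<^sup>2) (D\<^sup>2)" for A' B'
    by (simp add: Fract_conv_to_fract power2_eq_square diff_divide_distrib)
  ultimately show ?thesis
    by (simp only: norm_deg_def residue_class_minus field_norm_residue_class diff_pCons diff_0_right)
qed

text \<open>If \<open>A - a * D\<close> has smaller degree than \<open>D\<close>, it is the
  remainder itself; otherwise its degree is at least that of \<open>D\<close>, which the remainder
  does not reach. For \<open>D = 0\<close> both sides are \<open>degree A\<close>.\<close>

lemma degree_mod_le_degree_diff_multiple:
  fixes A D :: "'a::field poly"
  shows "degree (A mod D) \<le> degree (A - a * D)"
proof (cases "degree (A - a * D) < degree D")
  case True
  have "A mod D = ((A - a * D) + a * D) mod D" by simp
  also have "\<dots> = (A - a * D) mod D" by (rule mod_mult_self1)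
  also have "\<dots> = A - a * D" by (rule mod_poly_less[OF True])
  finally show ?thesis by simp
next
  case False
  show ?thesis
  proof (cases "D = 0")
    case False
    then show ?thesis
      using degree_mod_less[of D A] \<open>\<not> degree (A - a * D) < degree D\<close> by auto
  qed simp
qed

text \<open>No cancellation occurs between the two terms of the norm, so they can be minimised
  independently, and the pair of quotients by \<open>D\<close> is optimal for both at once.
  Attainment and lower bound together determine the \<open>LEAST\<close> in
  \<open>min_norm_deg\<close>.\<close>

lemma min_norm_deg_spec:
  fixes f A B D :: "'a::field poly"
  assumes nsq: "\<nexists>c. lead_coeff f = c ^ 2" and D: "D \<noteq> 0"
  defines "x \<equiv> residue_class f [:Fract A D, Fract B D:]"
    and "y0 \<equiv> residue_class f [:to_fract (A div D), to_fract (B div D):]"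
    and "d \<equiv> deg_infinity (Fract ((A mod D)\<^sup>2 - f * (B mod D)\<^sup>2) (D\<^sup>2))"
  shows "norm_deg f x y0 = d"
    and "y \<in> integer_ring f \<Longrightarrow> d \<le> norm_deg f x y"
    and "min_norm_deg f x = d"
proof -
  note deg = degree_square_minus[OF nsq]
  show y0: "norm_deg f x y0 = d"
    unfolding x_def y0_def d_def norm_deg_eq[OF D] by (simp add: minus_div_mult_eq_mod)
  show le: "d \<le> norm_deg f x y" if "y \<in> integer_ring f" for y
  proof -
    obtain a b where y: "y = residue_class f [:to_fract a, to_fract b:]"
      using \<open>y \<in> integer_ring f\<close> by (auto simp: integer_ring_eq)
    define A' B' where "A' = A - a * D" and "B' = B - b * D"
    define n n' where "n = (A mod D)\<^sup>2 - f * (B mod D)\<^sup>2" and "n' = A'\<^sup>2 - f * B'\<^sup>2"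
    have nd: "norm_deg f x y = deg_infinity (Fract n' (D\<^sup>2))"
      unfolding x_def y norm_deg_eq[OF D] n'_def A'_def B'_def ..
    have modA: "A mod D = A' mod D" and modB: "B mod D = B' mod D"
      unfolding A'_def B'_def by (metis mod_mult_self3 diff_add_cancel add.commute)+
    show ?thesis
    proof (cases "n = 0")
      \<comment> \<open>Here \<open>d\<close> is \<open>Minf\<close>, the least value of
        all.\<close>
      case True
      then show ?thesis
        by (simp add: d_def n_def[symmetric] deg_infinity_0 fract_collapse)
    next
      case False
      \<comment> \<open>Otherwise \<open>A'\<close> and \<open>B'\<close> vanish, hence also their
        remainders modulo \<open>D\<close>, and \<open>n = 0\<close>.\<close>
      then have n': "n' \<noteq> 0"
        unfolding n_def n'_def deg(2) modA modB by auto
      have f0: "f \<noteq> 0" using nsq by (metis coeff_0 power_zero_numeral)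
      have "degree (A mod D) \<le> degree A'" "degree (B mod D) \<le> degree B'"
        unfolding A'_def B'_def by (rule degree_mod_le_degree_diff_multiple)+
      \<comment> \<open>The degrees alone do not exclude a nonzero constant \<open>B mod D\<close>
        against \<open>B' = 0\<close>, where the factor \<open>f\<close> could reverse the
        inequality.\<close>
      moreover have "B' = 0 \<Longrightarrow> B mod D = 0" by (simp add: modB)
      ultimately have "degree ((A mod D)\<^sup>2) \<le> degree (A'\<^sup>2)"
        "degree (f * (B mod D)\<^sup>2) \<le> degree (f * B'\<^sup>2)"
        using f0 by (cases "A mod D = 0"; cases "B mod D = 0"; cases "A' = 0"; cases "B' = 0";
            simp add: degree_power_eq degree_mult_eq)+
      then have "degree n \<le> degree n'"
        unfolding n_def n'_def deg(1) by (rule max.mono)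
      then show ?thesis
        using False n' D by (simp add: nd d_def n_def[symmetric] deg_infinity_Fract)
    qed
  qed
  have "y0 \<in> integer_ring f" by (auto simp: y0_def integer_ring_eq)
  then show "min_norm_deg f x = d"
    unfolding min_norm_deg_def by (intro Least_equality) (auto simp: y0[symmetric] le[unfolded y0[symmetric]])
qed

section \<open>The Euclidean minimum\<close>

theorem theorem10:
  fixes f :: "'k::field poly" and g :: nat
  assumes "perfect_field TYPE('k)"
    and "CHAR('k) \<noteq> 2"
    and "g \<ge> 1"
    and "degree f = 2 * g + 2"
    and "\<nexists>c. lead_coeff f = c ^ 2"
    and "no_repeated_roots f"
  shows "(\<forall>x \<in> carrier (function_field f).
            \<exists>y\<^sub>0 \<in> integer_ring f. \<forall>y \<in> integer_ring f. norm_deg f x y\<^sub>0 \<le> norm_deg f x y) \<and>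
         (\<exists>x\<^sub>0 \<in> carrier (function_field f). \<forall>x \<in> carrier (function_field f).
            min_norm_deg f x \<le> min_norm_deg f x\<^sub>0) \<and>
         euclidean_minimum f = Fin (2 * int g)"
proof -
  note nsq = assms(5)
  have f0: "f \<noteq> 0" using assms by auto
  note deg = degree_square_minus[OF nsq] and spec = min_norm_deg_spec[OF nsq]
  have rep: "\<exists>A B D. D \<noteq> 0 \<and> x = residue_class f [:Fract A D, Fract B D:]"
    if x_in: "x \<in> carrier (function_field f)" for x
  proof -
    obtain u v where x: "x = residue_class f [:u, v:]"
      using x_in by (auto simp: carrier_function_field)
    obtain A B D where "D \<noteq> 0" "u = Fract A D" "v = Fract B D"
      by (rule fract_common_denominator)
    with x show ?thesis by blast
  qed
  have attained: "\<exists>y0 \<in> integer_ring f. \<forall>y \<in> integer_ring f. norm_deg f x y0 \<le> norm_deg f x y"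
    if x_in: "x \<in> carrier (function_field f)" for x
  proof -
    obtain A B D where D: "D \<noteq> 0" and x: "x = residue_class f [:Fract A D, Fract B D:]"
      using rep[OF x_in] by blast
    have "residue_class f [:to_fract (A div D), to_fract (B div D):] \<in> integer_ring f"
      by (auto simp: integer_ring_eq)
    then show ?thesis
      unfolding x using spec(1,2)[OF D] by metis
  qed
  have bound: "min_norm_deg f x \<le> Fin (2 * int g)" if x_in: "x \<in> carrier (function_field f)" for x
  proof -
    obtain A B D where D: "D \<noteq> 0" and x: "x = residue_class f [:Fract A D, Fract B D:]"
      using rep[OF x_in] by blast
    define n where "n = (A mod D)\<^sup>2 - f * (B mod D)\<^sup>2"
    have eq: "min_norm_deg f x = deg_infinity (Fract n (D\<^sup>2))"
      unfolding x n_def by (rule spec(3)[OF D])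
    show ?thesis
    proof (cases "n = 0")
      case True
      then show ?thesis by (simp add: eq deg_infinity_0 fract_collapse)
    next
      case False
      have "degree ((A mod D)\<^sup>2) \<le> 2 * g + 2 * degree D"
        using degree_mod_less[OF D, of A]
        by (cases "A mod D = 0") (auto simp: degree_power_eq)
      \<comment> \<open>A nonzero remainder has degree at most \<open>degree D - 1\<close>, and (2 g
        + 2) + 2 (deg D - 1) = 2 g + 2 deg D. The square of \<open>A mod D\<close> stays below this
        bound with room to spare.\<close>
      moreover have "degree (f * (B mod D)\<^sup>2) \<le> 2 * g + 2 * degree D"
        using degree_mod_less[OF D, of B] f0 assms(4)
        by (cases "B mod D = 0") (auto simp: degree_mult_eq degree_power_eq)
      ultimately have "degree n \<le> 2 * g + 2 * degree D"
        unfolding n_def deg(1) by simp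
      then show ?thesis
        using False D by (simp add: eq deg_infinity_Fract degree_power_eq)
    qed
  qed
  \<comment> \<open>With \<open>t\<close> for X, the element \<open>x0\<close> is Y / X. Its
    numerators 0 and 1 are already reduced modulo \<open>t\<close>, so its minimal norm is -f / X^2,
    of degree (2 g + 2) - 2.\<close>
  define t :: "'k poly" where "t = [:0, 1:]"
  define x0 where "x0 = residue_class f [:Fract 0 t, Fract 1 t:]"
  have x0: "x0 \<in> carrier (function_field f)"
    unfolding x0_def carrier_function_field by auto
  have t: "t \<noteq> 0" "degree t = 1" by (simp_all add: t_def)
  have "1 mod t = 1" using t by (simp add: mod_poly_less)
  then have min_x0: "min_norm_deg f x0 = Fin (2 * int g)"
    unfolding x0_def spec(3)[OF t(1)]
    using f0 t assms(4) by (simp add: deg_infinity_Fract degree_power_eq)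
  \<comment> \<open>The value at \<open>x0\<close> bounds all the others, so the
    \<open>GREATEST\<close> is determined.\<close>
  then have "euclidean_minimum f = Fin (2 * int g)"
    unfolding euclidean_minimum_def using bound x0
    by (intro Greatest_equality) (force, auto)
  moreover have "\<forall>x \<in> carrier (function_field f). min_norm_deg f x \<le> min_norm_deg f x0"
    using bound min_x0 by simp
  ultimately show ?thesis
    using attained x0 by blast
qed

end
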